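(* Let $\mathfrak{A}_1,\dots,\mathfrak{A}_n$ be algebras of sets with measures $m_1,\dots,m_n$, let $\Theta=\mathfrak{A}_1\times\cdots\times\mathfrak{A}_n$, and let $F:\Theta\to\mathbb{R}$ be an $n$-ary function of set. If $F$ attains its minimum over $\Theta$ at $(A_1,\dots,A_n)\in\Theta$, then the inner gradient of $F$ at $(A_1,\dots,A_n)$ satisfies $$\nabla F^{-}(A_1,\dots,A_n)\le 0,$$ i.e. for each $i=1,\dots,n$ and each sequence $\{B^i_k\}_{k\ge 1}$ in $\mathfrak{A}_i$ converging to a set $B^i\subseteq A_i$ for which the partial derivative exists, $$\frac{\partial F}{\partial m_i}\bigg|_{\{B^i_k\}\to B^i\subseteq A_i}\le 0.$$
   Context: Setting. For each $i$, $\mathfrak{A}_i=\mathfrak{A}(\Omega_i)$ is an algebra of sets over a base set $\Omega_i$ (it contains $\varnothing$ and is closed under $\cup,\cap,\setminus$ and the symmetric difference $\Delta$), and $m_i:\mathfrak{A}_i\to[0,\infty)$ is a "measure of a system of sets", i.e. (dropping the index $i$) one of the following, with $m(\varnothing)=0$ and $H$ a nowhere-vanishing weight function on points: (i) $\Omega$ is finite, $\mathfrak{A}$ consists of subsets of $\Omega$, and $m(A)=\sum_{\omega\in A}H(\omega)$ for $A\ne\varnothing$; (ii) $\Omega=[0,1]$, the elements of $\mathfrak{A}$ are formed from subintervals of $[0,1]$ (open, closed, half-open, possibly degenerate) and have the structure $A=\{K,Q\}$ with $K$ the continual part and $Q$ the set of isolated points, and $m(A)=\mu_l(K)+c\sum_{x\in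 Q}H(x)$ for $A\neq\varnothing$, with $\mu_l$ Lebesgue measure and $c>0$ a constant; (iii) as in (ii), but the system of intervals is supplemented by the Cantor set, the elements have the structure $A=\{K,f,Q\}$ with $f$ a subset of the Cantor set, and $m(A)=\alpha_1\mu_l(K)+\alpha_2\mu_c(f)+\alpha_3\sum_{x\in Q}H(x)$ for $A\ne\varnothing$, with $\mu_c$ a Carathéodory measure and $\alpha_1,\alpha_2,\alpha_3$ constant coefficients. In all cases $m$ has the standing properties: (p1) $m(A)\ge 0$, and $m(A)=0$ implies $A=\varnothing$; (p2) $m(A\cup B)=m(A)+m(B)-m(A\cap B)$ for all $A,B\in\mathfrak{A}$. Convergence. A sequence $\{B_k\}$ in $\mathfrak{A}_i$ converges to $B\in\mathfrak{A}_i$ if for every $\varepsilon>0$ there is $k(\varepsilon)$ such that $m_i(B_k\Delta B)<\varepsilon$ for all $k>k(\varepsilon)$. Partial derivatives and gradient. An $n$-ary function of set is a map $F:\Theta\to\mathbb{R}$. The partial derivative of $F$ at $(A_1,\dots,A_n)$ by the measure $m_i$ on a sequence $\{B^i_k\}_{k\ge1}$ in $\mathfrak{A}_i$ is the limit, if it exists, $$\frac{\partial F}{\partial m_i}\bigg|_{\{B^i_k\}}=\lim_{k\to\infty}\frac{F(A_1,\dots,A_i\Delta B^i_k,\dots,A_n)-F(A_1,\dots,A_i,\dots,A_n)}{m_i(A_i\Delta B^i_k)-m_i(A_i)},$$ where the denominators are understood to be nonzero. The gradient $\nabla F$ is the vector of these partial derivatives, $i=1,\dots,n$; the inner gradient $\nabla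 F^{-}$ is the vector whose components are the partial derivatives taken on sequences $\{B^i_k\}$ converging to a set $B^i\subseteq A_i$. The inequality $\nabla F^-\le 0$ is componentwise.
   Formalization: When the limit set B^i is empty, the sets B^i_k are additionally assumed to be eventually subsets of A_i; without this the claim fails, e.g. for F = m Lebesgue measure on half-open intervals, A = ∅, B_k = [0,1/k), where the derivative is 1. *)

theory Defs
  imports "HOL-Analysis.Analysis"
begin

subsection \<open>Measures of systems of sets\<close>

text \<open>
  All base sets share one point type \<open>'a\<close>, so the unit interval enters through embeddings into
  \<open>'a\<close>, one for each part of the structure \<open>{K, Q}\<close> (continual part and isolated points) or
  \<open>{K, f, Q}\<close> (with \<open>f\<close> a subset of the Cantor set).  The embeddings may coincide: then \<open>A\<close> is
  literally a subset of (a copy of) \<open>[0,1]\<close>.  They may also have disjoint images: then \<open>A\<close> is the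
  tuple of its parts and the set operations act part by part.  The second possibility matters,
  because on subsets of \<open>[0,1]\<close> the formulas are not additive for touching intervals:
  \<open>[0,1/2]\<close> and \<open>[1/2,1]\<close> have union of measure 1 and meet in the isolated point \<open>1/2\<close>, which
  has nonzero measure.
\<close>

definition finite_kind :: "'a set \<Rightarrow> 'a set set \<Rightarrow> ('a set \<Rightarrow> real) \<Rightarrow> bool" where
  "finite_kind \<Omega> \<AA> m \<longleftrightarrow> finite \<Omega> \<and>
    (\<exists>H. (\<forall>\<omega>\<in>\<Omega>. H \<omega> \<noteq> 0) \<and> (\<forall>A\<in>\<AA>. A \<noteq> {} \<longrightarrow> m A = (\<Sum>\<omega>\<in>A. H \<omega>)))"

definition unit_subintervals :: "real set set" where
  "unit_subintervals = {J. is_interval J \<and> J \<subseteq> {0..1}}"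

definition interval_kind :: "'a set \<Rightarrow> 'a set set \<Rightarrow> ('a set \<Rightarrow> real) \<Rightarrow> bool" where
  "interval_kind \<Omega> \<AA> m \<longleftrightarrow>
    (\<exists>(\<kappa> :: real \<Rightarrow> 'a) (\<iota> :: real \<Rightarrow> 'a) (c :: real) (H :: real \<Rightarrow> real).
      inj_on \<kappa> {0..1} \<and> inj_on \<iota> {0..1} \<and> \<Omega> = \<kappa> ` {0..1} \<union> \<iota> ` {0..1} \<and>
      c > 0 \<and> (\<forall>x\<in>{0..1}. H x \<noteq> 0) \<and>
      (\<forall>A\<in>\<AA>. A \<noteq> {} \<longrightarrow>
        (\<exists>K Q. K \<in> ring_of_sets {0..1} hull unit_subintervals \<and>
          finite Q \<and> Q \<subseteq> {0..1} \<and> A = \<kappa> ` K \<union> \<iota> ` Q \<and>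
          m A = measure lebesgue K + c * (\<Sum>x\<in>Q. H x))))"

primrec cantor_stage :: "nat \<Rightarrow> real set" where
  "cantor_stage 0 = {0..1}"
| "cantor_stage (Suc k) = (\<lambda>x. x / 3) ` cantor_stage k \<union> (\<lambda>x. (x + 2) / 3) ` cantor_stage k"

definition cantor_set :: "real set" where
  "cantor_set = (\<Inter>k. cantor_stage k)"

text \<open>
  A Caratheodory measure on the Cantor set is an outer measure \<open>\<nu>\<close> on its subsets, restricted to
  the sets that are measurable in Caratheodory's sense (\<^const>\<open>lambda_system\<close>).
\<close>

definition cantor_kind :: "'a set \<Rightarrow> 'a set set \<Rightarrow> ('a set \<Rightarrow> real) \<Rightarrow> bool" where
  "cantor_kind \<Omega> \<AA> m \<longleftrightarrow>
    (\<exists>(\<kappa> :: real \<Rightarrow> 'a) (\<gamma> :: real \<Rightarrow> 'a) (\<iota> :: real \<Rightarrow> 'a)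
      (\<nu> :: real set \<Rightarrow> ennreal) (\<alpha>1 :: real) (\<alpha>2 :: real) (\<alpha>3 :: real) (H :: real \<Rightarrow> real).
      inj_on \<kappa> {0..1} \<and> inj_on \<gamma> cantor_set \<and> inj_on \<iota> {0..1} \<and>
      \<Omega> = \<kappa> ` {0..1} \<union> \<gamma> ` cantor_set \<union> \<iota> ` {0..1} \<and>
      outer_measure_space (Pow cantor_set) \<nu> \<and> (\<forall>x\<in>{0..1}. H x \<noteq> 0) \<and>
      (\<forall>A\<in>\<AA>. A \<noteq> {} \<longrightarrow>
        (\<exists>K f Q. K \<in> ring_of_sets {0..1} hull (insert cantor_set unit_subintervals) \<and>
          f \<in> lambda_system cantor_set (Pow cantor_set) \<nu> \<and> \<nu> f < \<infinity> \<and>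
          finite Q \<and> Q \<subseteq> {0..1} \<and> A = \<kappa> ` K \<union> \<gamma> ` f \<union> \<iota> ` Q \<and>
          m A = \<alpha>1 * measure lebesgue K + \<alpha>2 * enn2real (\<nu> f) + \<alpha>3 * (\<Sum>x\<in>Q. H x))))"

text \<open>An algebra of sets need not contain its base set, so it is a \<^const>\<open>ring_of_sets\<close>.\<close>

definition set_system_measure :: "'a set \<Rightarrow> 'a set set \<Rightarrow> ('a set \<Rightarrow> real) \<Rightarrow> bool" where
  "set_system_measure \<Omega> \<AA> m \<longleftrightarrow> ring_of_sets \<Omega> \<AA> \<and>
    (finite_kind \<Omega> \<AA> m \<or> interval_kind \<Omega> \<AA> m \<or> cantor_kind \<Omega> \<AA> m) \<and>
    m {} = 0 \<and>
    (\<forall>A\<in>\<AA>. m A \<ge> 0 \<and> (m A = 0 \<longrightarrow> A = {})) \<and>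
    (\<forall>A\<in>\<AA>. \<forall>B\<in>\<AA>. m (A \<union> B) = m A + m B - m (A \<inter> B))"


subsection \<open>Convergence and partial derivatives\<close>

text \<open>Sequences are indexed from 1; their value at index 0 is irrelevant.\<close>

definition set_seq_converges ::
  "'a set set \<Rightarrow> ('a set \<Rightarrow> real) \<Rightarrow> (nat \<Rightarrow> 'a set) \<Rightarrow> 'a set \<Rightarrow> bool" where
  "set_seq_converges \<AA> m S B \<longleftrightarrow> (\<forall>k\<ge>1. S k \<in> \<AA>) \<and> B \<in> \<AA> \<and>
    (\<forall>\<epsilon>>0. \<exists>k0\<ge>1. \<forall>k>k0. m (sym_diff (S k) B) < \<epsilon>)"

definition has_set_partial_derivative ::
  "((nat \<Rightarrow> 'a set) \<Rightarrow> real) \<Rightarrow> (nat \<Rightarrow> 'a set \<Rightarrow> real) \<Rightarrow> (nat \<Rightarrow> 'a set) \<Rightarrow> nat \<Rightarrow>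
    (nat \<Rightarrow> 'a set) \<Rightarrow> real \<Rightarrow> bool" where
  "has_set_partial_derivative F m A i S D \<longleftrightarrow>
    (\<forall>k\<ge>1. m i (sym_diff (A i) (S k)) - m i (A i) \<noteq> 0) \<and>
    (\<lambda>k. (F (A(i := sym_diff (A i) (S k))) - F A) / (m i (sym_diff (A i) (S k)) - m i (A i)))
      \<longlonglongrightarrow> D"

text \<open>A component of the inner gradient: the partial derivative on a sequence with limit \<open>B \<subseteq> A i\<close>.\<close>

definition has_inner_partial_derivative ::
  "((nat \<Rightarrow> 'a set) \<Rightarrow> real) \<Rightarrow> (nat \<Rightarrow> 'a set set) \<Rightarrow> (nat \<Rightarrow> 'a set \<Rightarrow> real) \<Rightarrow>
    (nat \<Rightarrow> 'a set) \<Rightarrow> nat \<Rightarrow> (nat \<Rightarrow> 'a set) \<Rightarrow> 'a set \<Rightarrow> real \<Rightarrow> bool" where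
  "has_inner_partial_derivative F \<AA> m A i S B D \<longleftrightarrow>
    set_seq_converges (\<AA> i) (m i) S B \<and> B \<subseteq> A i \<and> has_set_partial_derivative F m A i S D"

end

theory Submission
  imports Defs
begin

text \<open>
  At a minimum the numerator \<open>F (A(i := sym_diff (A i) (S k))) - F A\<close> of every difference quotient
  is nonnegative, so it suffices that the denominators are eventually at most 0.  Let \<open>S\<close> converge
  to \<open>B \<subseteq> A i\<close>.  Since \<open>A i \<triangle> S k\<close> differs from \<open>A i \<triangle> B = A i - B\<close> only by \<open>S k \<triangle> B\<close>,
  subadditivity of the measure gives
  \<open>m (A i \<triangle> S k) - m (A i) \<le> m (S k \<triangle> B) - m B\<close>,
  as in \<open>measure_sym_diff_increment_le\<close>.  If \<open>B \<noteq> {}\<close>, then \<open>m B > 0\<close> because only the empty set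
  has measure 0, and the right-hand side is eventually negative.  If \<open>B = {}\<close>, this bound does not
  determine a sign: sets of small measure outside \<open>A i\<close> also converge to the empty set, and they
  make the denominator positive.  There \<open>S k \<subseteq> A i\<close> holds eventually by hypothesis, and the bound with
  \<open>S k\<close> in place of \<open>B\<close> shows that the denominator is at most \<open>- m (S k)\<close>.
\<close>

lemma set_system_measure_mono:
  assumes "set_system_measure \<Omega> \<AA> m" "X \<in> \<AA>" "Y \<in> \<AA>" "X \<subseteq> Y"
  shows "m X \<le> m Y"
proof -
  interpret ring_of_sets \<Omega> \<AA>
    using assms(1) by (simp add: set_system_measure_def)
  have "Y - X \<in> \<AA>" using assms by blast
  then have "m (X \<union> (Y - X)) = m X + m (Y - X) - m (X \<inter> (Y - X))" "m (Y - X) \<ge> 0" "m {} = 0"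
    using assms unfolding set_system_measure_def by blast+
  moreover have "X \<union> (Y - X) = Y" "X \<inter> (Y - X) = {}" using assms(4) by auto
  ultimately show ?thesis by simp
qed

lemma set_system_measure_subadditive:
  assumes "set_system_measure \<Omega> \<AA> m" "X \<in> \<AA>" "Y \<in> \<AA>"
  shows "m (X \<union> Y) \<le> m X + m Y"
proof -
  interpret ring_of_sets \<Omega> \<AA>
    using assms(1) by (simp add: set_system_measure_def)
  have "X \<inter> Y \<in> \<AA>" using assms by blast
  then have "m (X \<union> Y) = m X + m Y - m (X \<inter> Y)" "m (X \<inter> Y) \<ge> 0"
    using assms unfolding set_system_measure_def by blast+
  then show ?thesis by simp
qed

lemma set_system_measure_Diff:
  assumes "set_system_measure \<Omega> \<AA> m" "X \<in> \<AA>" "Y \<in> \<AA>" "Y \<subseteq> X"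
  shows "m (X - Y) = m X - m Y"
proof -
  interpret ring_of_sets \<Omega> \<AA>
    using assms(1) by (simp add: set_system_measure_def)
  have "X - Y \<in> \<AA>" using assms by blast
  then have "m (Y \<union> (X - Y)) = m Y + m (X - Y) - m (Y \<inter> (X - Y))" "m {} = 0"
    using assms unfolding set_system_measure_def by blast+
  moreover have "Y \<union> (X - Y) = X" "Y \<inter> (X - Y) = {}" using assms(4) by auto
  ultimately show ?thesis by simp
qed

text \<open>
  Modifying \<open>X\<close> by \<open>T\<close> instead of by \<open>B\<close> costs at most the distance \<open>m (sym_diff T B)\<close>, and
  modifying it by a subset \<open>B\<close> removes exactly \<open>m B\<close>.
\<close>

lemma measure_sym_diff_increment_le:
  assumes M: "set_system_measure \<Omega> \<AA> m"
    and in_ring: "X \<in> \<AA>" "T \<in> \<AA>" "B \<in> \<AA>" and "B \<subseteq> X"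
  shows "m (sym_diff X T) - m X \<le> m (sym_diff T B) - m B"
proof -
  interpret ring_of_sets \<Omega> \<AA>
    using M by (simp add: set_system_measure_def)
  have mem: "sym_diff X T \<in> \<AA>" "sym_diff T B \<in> \<AA>" "X - B \<in> \<AA>"
    using in_ring by blast+
  have "m (sym_diff X T) \<le> m ((X - B) \<union> sym_diff T B)"
    using \<open>B \<subseteq> X\<close> mem by (intro set_system_measure_mono[OF M]) blast+
  also have "\<dots> \<le> m (X - B) + m (sym_diff T B)"
    by (rule set_system_measure_subadditive[OF M mem(3,2)])
  also have "m (X - B) = m X - m B"
    by (rule set_system_measure_Diff[OF M in_ring(1,3) \<open>B \<subseteq> X\<close>])
  finally show ?thesis by simp
qed

lemma eventually_measure_increment_nonpos:
  assumes M: "set_system_measure \<Omega> \<AA> m" and "X \<in> \<AA>"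
    and conv: "set_seq_converges \<AA> m S B" and "B \<subseteq> X"
    and inside: "B = {} \<longrightarrow> (\<forall>\<^sub>F k in sequentially. S k \<subseteq> X)"
  shows "\<forall>\<^sub>F k in sequentially. m (sym_diff X (S k)) - m X \<le> 0"
proof (cases "B = {}")
  case True
  have S_in: "\<forall>\<^sub>F k in sequentially. S k \<in> \<AA>"
    using conv by (auto simp: set_seq_converges_def intro: eventually_sequentiallyI)
  have "\<forall>\<^sub>F k in sequentially. S k \<subseteq> X"
    using inside True by blast
  with S_in show ?thesis
  proof eventually_elim
    case (elim k)
    have "m (sym_diff X (S k)) - m X \<le> m (sym_diff (S k) (S k)) - m (S k)"
      by (rule measure_sym_diff_increment_le[OF M \<open>X \<in> \<AA>\<close> elim(1,1,2)])
    moreover have "m {} = 0" "m (S k) \<ge> 0"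
      using M elim(1) unfolding set_system_measure_def by blast+
    ultimately show ?case by simp
  qed
next
  case False
  have B: "B \<in> \<AA>" using conv by (simp add: set_seq_converges_def)
  have "m B \<ge> 0" "m B \<noteq> 0"
    using M B False unfolding set_system_measure_def by blast+
  then have "m B > 0" by simp
  then obtain k0 where k0: "\<And>k. k > k0 \<Longrightarrow> m (sym_diff (S k) B) < m B"
    using conv unfolding set_seq_converges_def by blast
  show ?thesis
  proof (rule eventually_sequentiallyI)
    fix k assume "k \<ge> Suc k0"
    then have "S k \<in> \<AA>" "m (sym_diff (S k) B) < m B"
      using conv k0 by (auto simp: set_seq_converges_def)
    with measure_sym_diff_increment_le[OF M \<open>X \<in> \<AA>\<close> _ B \<open>B \<subseteq> X\<close>, of "S k"]
    show "m (sym_diff X (S k)) - m X \<le> 0" by simp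
  qed
qed

theorem theorem6:
  fixes n :: nat
    and \<Omega> :: "nat \<Rightarrow> 'a set"
    and \<AA> :: "nat \<Rightarrow> 'a set set"
    and m :: "nat \<Rightarrow> 'a set \<Rightarrow> real"
    and F :: "(nat \<Rightarrow> 'a set) \<Rightarrow> real"
    and A :: "nat \<Rightarrow> 'a set"
  assumes "\<forall>i\<in>{1..n}. set_system_measure (\<Omega> i) (\<AA> i) (m i)"
    and "A \<in> PiE {1..n} \<AA>"
    and "\<forall>X\<in>PiE {1..n} \<AA>. F A \<le> F X"
  shows "\<forall>i\<in>{1..n}. \<forall>S B D.
    has_inner_partial_derivative F \<AA> m A i S B D \<and>
    (B = {} \<longrightarrow> (\<forall>\<^sub>F k in sequentially. S k \<subseteq> A i))
    \<longrightarrow> D \<le> 0"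
proof (intro ballI allI impI, elim conjE)
  fix i S B D
  assume i: "i \<in> {1..n}"
    and deriv: "has_inner_partial_derivative F \<AA> m A i S B D"
    and inside: "B = {} \<longrightarrow> (\<forall>\<^sub>F k in sequentially. S k \<subseteq> A i)"
  have M: "set_system_measure (\<Omega> i) (\<AA> i) (m i)" using assms(1) i by blast
  interpret ring_of_sets "\<Omega> i" "\<AA> i"
    using M by (simp add: set_system_measure_def)
  have Ai: "A i \<in> \<AA> i" using assms(2) i by blast
  have conv: "set_seq_converges (\<AA> i) (m i) S B" and "B \<subseteq> A i"
    and lim: "(\<lambda>k. (F (A(i := sym_diff (A i) (S k))) - F A) /
                   (m i (sym_diff (A i) (S k)) - m i (A i))) \<longlonglongrightarrow> D"
    using deriv by (auto simp: has_inner_partial_derivative_def has_set_partial_derivative_def)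
  have "\<forall>\<^sub>F k in sequentially. S k \<in> \<AA> i"
    using conv by (auto simp: set_seq_converges_def intro: eventually_sequentiallyI)
  moreover have "\<forall>\<^sub>F k in sequentially. m i (sym_diff (A i) (S k)) - m i (A i) \<le> 0"
    by (rule eventually_measure_increment_nonpos[OF M Ai conv \<open>B \<subseteq> A i\<close> inside])
  ultimately have "\<forall>\<^sub>F k in sequentially.
      (F (A(i := sym_diff (A i) (S k))) - F A) / (m i (sym_diff (A i) (S k)) - m i (A i)) \<le> 0"
  proof eventually_elim
    case (elim k)
    have "sym_diff (A i) (S k) \<in> \<AA> i" using Ai elim(1) by blast
    then have "A(i := sym_diff (A i) (S k)) \<in> PiE {1..n} \<AA>"
      using assms(2) i by (auto simp: PiE_iff extensional_def)
    then have "F A \<le> F (A(i := sym_diff (A i) (S k)))" using assms(3) by blast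
    with elim(2) show ?case by (intro divide_nonneg_nonpos) simp_all
  qed
  then show "D \<le> 0" by (rule tendsto_upperbound[OF lim]) simp
qed

end
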